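(* Let $G$ be a finite abstract simplicial complex with connection Laplacian $L=L(G)$, and let $n(G)$ be the Morse index of $L$, that is, the number of negative eigenvalues of $L$ counted with multiplicity. Then $n(G)$ is equal to the number of odd-dimensional simplices in $G$, and $$(-1)^{n(G)}=\exp(-\zeta_L'(0))=\det(L(G)),$$ where $\zeta_L(s)=\sum_k\lambda_k^{-s}$ is the sum over the eigenvalues $\lambda_k$ of $L$ counted with multiplicity.
   Context: A finite abstract simplicial complex $G$ is a finite set of non-empty finite sets (simplices) closed under taking non-empty subsets; the dimension of $x\in G$ is $|x|-1$. The connection Laplacian $L$ is the $|G|\times|G|$ matrix indexed by $G$ with $L(x,y)=1$ if $x\cap y\ne\emptyset$ and $0$ otherwise; it is symmetric and it is known that $|\det L|=1$, so all eigenvalues are real and non-zero. Powers are $\lambda^{-s}=e^{-s\log\lambda}$ with the branch $\log\lambda=\log|\lambda|+i\pi$ for $\lambda<0$ and the real logarithm for $\lambda>0$. *)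

theory Defs
  imports
    "HOL-Analysis.Complex_Transcendental"
    "Jordan_Normal_Form.Char_Poly"
begin

definition simplicial_complex :: "'a set set \<Rightarrow> bool" where
  "simplicial_complex G \<longleftrightarrow>
     finite G \<and>
     (\<forall>x\<in>G. finite x \<and> x \<noteq> {}) \<and>
     (\<forall>x\<in>G. \<forall>y. y \<subseteq> x \<and> y \<noteq> {} \<longrightarrow> y \<in> G)"

definition simplex_dim :: "'a set \<Rightarrow> int" where
  "simplex_dim x = int (card x) - 1"

text \<open>Matrices are indexed by numbers, so the connection Laplacian takes the simplices in the
  form of a list \<open>xs\<close> without repetitions; the order chosen only conjugates the matrix
  by a permutation.\<close>

definition connection_laplacian :: "'a set list \<Rightarrow> real mat" where
  "connection_laplacian xs =
     mat (length xs) (length xs) (\<lambda>(i, j). if xs ! i \<inter> xs ! j \<noteq> {} then 1 else 0)"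

text \<open>The real eigenvalues with algebraic multiplicity. For the symmetric matrices considered
  here these are all the eigenvalues, and the algebraic and geometric multiplicities agree.\<close>

definition eigenvalues_mset :: "real mat \<Rightarrow> real multiset" where
  "eigenvalues_mset A = proots (char_poly A)"

definition morse_index :: "real mat \<Rightarrow> nat" where
  "morse_index A = size {#l \<in># eigenvalues_mset A. l < 0#}"

text \<open>Complex \<open>powr\<close> uses the principal logarithm, whose imaginary part lies in
  \<open>{-pi<..pi}\<close>; for real \<open>l < 0\<close> it is \<open>ln \<bar>l\<bar> + \<i> * pi\<close>.\<close>

definition spectral_zeta :: "real mat \<Rightarrow> complex \<Rightarrow> complex" where
  "spectral_zeta A s = (\<Sum>l\<in>#eigenvalues_mset A. complex_of_real l powr (- s))"

end

theory Submission 
  imports Defs "Jordan_Normal_Form.Spectral_Radius"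
begin

text \<open>The whole result comes from one factorization. For simplices \<open>x\<close> and \<open>y\<close>, the non-empty
  subsets \<open>z\<close> of \<open>x \<inter> y\<close> are all simplices of the complex, and their signs
  \<open>(-1) ^ dim z\<close> add up to 1 if \<open>x \<inter> y\<close> is non-empty and to 0 otherwise. Hence
  \<open>L = Z D Z\<^sup>T\<close>, where \<open>Z(x, z) = 1\<close> if \<open>z \<subseteq> x\<close> and 0 otherwise, and \<open>D\<close> is the
  diagonal matrix of the signs (\<open>connection_laplacian_factorization\<close>). With respect to an
  ordering by dimension \<open>Z\<close> is unitriangular, so \<open>det Z = 1\<close> (\<open>det_face_matrix\<close>).

  Thus \<open>L\<close> is congruent to \<open>D\<close>, and the law of inertia (\<open>sylvester_law_of_inertia\<close>) says
  that \<open>L\<close> has as many negative eigenvalues as \<open>D\<close> has negative entries, one for each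
  odd-dimensional simplex. Also \<open>det L = det D = (-1) ^ n(G)\<close>. Finally each \<open>\<lambda> powr (-s)\<close>
  has derivative \<open>-Ln \<lambda>\<close> at 0, so \<open>exp (-\<zeta>'(0))\<close> is the product of all eigenvalues
  (\<open>exp_minus_deriv_spectral_zeta_0\<close>), and this is \<open>det L\<close>.

  The last step and the law of inertia both need an orthogonal diagonalization of \<open>L\<close> over
  the reals (\<open>real_spectral_theorem\<close>): it shows that the characteristic polynomial splits over the
  reals, with the diagonal entries as its roots.\<close>

unbundle no vec_syntax
unbundle no inner_syntax

section \<open>The spectral theorem for real symmetric matrices\<close>

text \<open>Over the complex numbers some eigenvalue \<open>e\<close> with eigenvector \<open>v\<close> exists. As the matrix
  is real and symmetric, the sum of \<open>cnj (v i) * A(i, j) * v j\<close> equals its own conjugate;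
  it is \<open>e\<close> times the squared norm of \<open>v\<close>, so \<open>e\<close> is real.\<close>

lemma symmetric_real_eigenvalue_exists:
  fixes A :: "real mat"
  assumes A: "A \<in> carrier_mat n n" and sym: "transpose_mat A = A" and n: "n > 0"
  shows "\<exists>e. eigenvalue A e"
proof -
  define C where "C = map_mat complex_of_real A"
  have C: "C \<in> carrier_mat n n" using A by (simp add: C_def)
  from spectrum_non_empty[OF C n] obtain e where e: "eigenvalue C e"
    by (auto simp: spectrum_def)
  then obtain v where v: "v \<in> carrier_vec n" and v0: "v \<noteq> 0\<^sub>v n" and Cv: "C *\<^sub>v v = e \<cdot>\<^sub>v v"
    using C by (auto simp: eigenvalue_def eigenvector_def)
  have symC: "C $$ (i, j) = C $$ (j, i)" if "i < n" "j < n" for i j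
    using that A arg_cong[OF sym, of "\<lambda>M. M $$ (i, j)"] by (simp add: C_def)
  have conjC: "cnj (C $$ (i, j)) = C $$ (i, j)" if "i < n" "j < n" for i j
    using that A by (simp add: C_def)
  have Cvi: "(\<Sum>j<n. C $$ (i, j) * v $ j) = e * v $ i" if "i < n" for i
    using arg_cong[OF Cv, of "\<lambda>w. w $ i"] that C v
    by (simp add: scalar_prod_def atLeast0LessThan)
  define N where "N = (\<Sum>i<n. v $ i * cnj (v $ i))"
  have "e * N = (\<Sum>i<n. cnj (v $ i) * (e * v $ i))"
    by (simp add: N_def sum_distrib_left mult_ac)
  also have "\<dots> = (\<Sum>i<n. cnj (v $ i) * (\<Sum>j<n. C $$ (i, j) * v $ j))"
    by (intro sum.cong refl) (simp add: Cvi)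
  also have "\<dots> = (\<Sum>i<n. \<Sum>j<n. cnj (v $ i) * C $$ (i, j) * v $ j)"
    by (simp add: sum_distrib_left mult_ac)
  also have "\<dots> = (\<Sum>j<n. \<Sum>i<n. cnj (v $ i) * C $$ (i, j) * v $ j)"
    by (rule sum.swap)
  also have "\<dots> = (\<Sum>j<n. v $ j * cnj (\<Sum>i<n. C $$ (j, i) * v $ i))"
    by (intro sum.cong refl) (auto simp: sum_distrib_left mult_ac conjC symC intro!: sum.cong)
  also have "\<dots> = (\<Sum>j<n. v $ j * cnj (e * v $ j))"
    by (intro sum.cong refl) (simp add: Cvi)
  also have "\<dots> = cnj e * N"
    by (simp add: N_def sum_distrib_left mult_ac)
  finally have eq: "e * N = cnj e * N" .
  have "N \<noteq> 0"
  proof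
    assume "N = 0"
    hence "(\<Sum>i<n. (cmod (v $ i))\<^sup>2) = 0"
      unfolding N_def complex_norm_square[symmetric] of_real_sum[symmetric] by (simp only: of_real_eq_0_iff)
    hence "\<forall>i<n. v $ i = 0" by (subst (asm) sum_nonneg_eq_0_iff) auto
    with v v0 show False by (auto intro!: eq_vecI)
  qed
  with eq have "cnj e = e" by simp
  then obtain r where r: "e = complex_of_real r" by (metis Reals_cnj_iff Reals_cases)
  have "poly (char_poly C) e = 0" using e eigenvalue_root_char_poly[OF C] by simp
  hence "poly (char_poly A) r = 0"
    unfolding C_def r of_real_hom.char_poly_hom[OF A] by simp
  thus ?thesis using eigenvalue_root_char_poly[OF A] by auto
qed

text \<open>Complete \<open>v\<close> to a basis, apply Gram-Schmidt, which keeps the first vector, and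
  normalize the resulting orthogonal vectors.\<close>

lemma orthonormal_extension:
  fixes v :: "real vec"
  assumes v: "v \<in> carrier_vec n" and v0: "v \<noteq> 0\<^sub>v n"
  shows "\<exists>W c. W \<in> carrier_mat n n \<and> transpose_mat W * W = 1\<^sub>m n \<and> col W 0 = c \<cdot>\<^sub>v v"
proof -
  interpret cof_vec_space n "TYPE(real)" .
  have n: "n > 0" using v v0 by (cases n) auto
  define b where "b = basis_completion v"
  note bc = basis_completion[OF v v0, folded b_def]
  define ws where "ws = gram_schmidt n b"
  from bc(6,7) n obtain vs where bv: "b = v # vs" by (cases b) auto
  from gram_schmidt_result[OF bc(2,4,5) ws_def]
  have ws: "set ws \<subseteq> carrier_vec n" "corthogonal ws" "length ws = n" by (auto simp: bc)
  from gram_schmidt_hd[OF v, of vs, folded bv] have "hd ws = v" unfolding ws_def .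
  hence ws0: "ws ! 0 = v" using ws(3) n by (cases ws) auto
  have wsc: "ws ! i \<in> carrier_vec n" if "i < n" for i using ws that by auto
  have conj: "conjugate w = w" for w :: "real vec" by (auto simp: vec_eq_iff)
  have orth: "ws ! i \<bullet> ws ! j = 0 \<longleftrightarrow> i \<noteq> j" if "i < n" "j < n" for i j
    using corthogonalD[OF ws(2), of i j] that by (simp add: ws(3) conj)
  define q where "q i = sqrt (ws ! i \<bullet> ws ! i)" for i
  have pos: "ws ! i \<bullet> ws ! i > 0" if "i < n" for i
  proof -
    have "ws ! i \<bullet> ws ! i \<ge> 0" by (auto simp: scalar_prod_def intro!: sum_nonneg)
    with orth[OF that that] show ?thesis by linarith
  qed
  define W where "W = mat n n (\<lambda>(i, j). ws ! j $ i / q j)"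
  have W: "W \<in> carrier_mat n n" by (simp add: W_def)
  have colW: "col W j = (1 / q j) \<cdot>\<^sub>v ws ! j" if "j < n" for j
    using that wsc[OF that] by (auto simp: W_def intro!: eq_vecI)
  have "transpose_mat W * W = 1\<^sub>m n"
  proof (rule eq_matI)
    fix i j assume "i < dim_row (1\<^sub>m n)" "j < dim_col (1\<^sub>m n)"
    hence ij: "i < n" "j < n" by auto
    have "(transpose_mat W * W) $$ (i, j) = col W i \<bullet> col W j" using ij W by simp
    also have "\<dots> = ws ! i \<bullet> ws ! j / (q i * q j)"
      using wsc[OF ij(1)] wsc[OF ij(2)] by (simp add: colW ij)
    also have "\<dots> = 1\<^sub>m n $$ (i, j)"
      using ij orth[OF ij] pos[OF ij(1)] by (auto simp: q_def)
    finally show "(transpose_mat W * W) $$ (i, j) = 1\<^sub>m n $$ (i, j)" .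
  qed (use W in auto)
  with W colW[OF n] ws0 show ?thesis by metis
qed

lemma mult_block_diagonal:
  fixes A1 :: "'a :: semiring_1 mat"
  assumes "A1 \<in> carrier_mat k k" "A2 \<in> carrier_mat k k" "B1 \<in> carrier_mat m m" "B2 \<in> carrier_mat m m"
  shows "four_block_mat A1 (0\<^sub>m k m) (0\<^sub>m m k) B1 * four_block_mat A2 (0\<^sub>m k m) (0\<^sub>m m k) B2
    = four_block_mat (A1 * A2) (0\<^sub>m k m) (0\<^sub>m m k) (B1 * B2)"
  using assms by (subst mult_four_block_mat[of _ k k _ m _ m _ _ k _ m]) auto

lemma mat_diag_Suc:
  "mat_diag (Suc n) d = four_block_mat (mat_diag 1 (\<lambda>_. d 0)) (0\<^sub>m 1 n) (0\<^sub>m n 1) (mat_diag n (\<lambda>i. d (Suc i)))"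
  by (rule eq_matI) (auto simp: mat_diag_def)

text \<open>Induction on the size: an orthogonal matrix \<open>W\<close> whose first column is an eigenvector
  turns \<open>A\<close> into a matrix with first column \<open>(e, 0, \<dots>, 0)\<close>. By symmetry the first row has
  the same form, so what remains is a smaller symmetric block.\<close>

theorem real_spectral_theorem:
  fixes A :: "real mat"
  assumes "A \<in> carrier_mat n n" and "transpose_mat A = A"
  shows "\<exists>P d. P \<in> carrier_mat n n \<and> transpose_mat P * P = 1\<^sub>m n \<and> transpose_mat P * A * P = mat_diag n d"
  using assms
proof (induction n arbitrary: A)
  case 0
  show ?case
    by (rule exI[of _ "1\<^sub>m 0"], rule exI[of _ "\<lambda>_. 0"]) (use 0 in \<open>auto simp: mat_diag_def intro!: eq_matI\<close>)
next
  case (Suc m A)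
  let ?n = "Suc m"
  note A = Suc.prems(1)
  from symmetric_real_eigenvalue_exists[OF Suc.prems] obtain e where "eigenvalue A e" by auto
  then obtain v where v: "v \<in> carrier_vec ?n" "v \<noteq> 0\<^sub>v ?n" and Av: "A *\<^sub>v v = e \<cdot>\<^sub>v v"
    using A by (auto simp: eigenvalue_def eigenvector_def)
  from orthonormal_extension[OF v] obtain W c where W: "W \<in> carrier_mat ?n ?n"
    and WW: "transpose_mat W * W = 1\<^sub>m ?n" and W0: "col W 0 = c \<cdot>\<^sub>v v" by auto
  define S where "S = transpose_mat W * A * W"
  have S: "S \<in> carrier_mat ?n ?n" using W A by (simp add: S_def)
  have symS: "transpose_mat S = S"
    unfolding S_def using W A Suc.prems(2)
    by (simp add: transpose_mult[of _ ?n ?n _ ?n] assoc_mult_mat[of _ ?n ?n _ ?n _ ?n])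
  have AW0: "A *\<^sub>v col W 0 = e \<cdot>\<^sub>v col W 0"
    using A v Av by (simp add: W0 mult_mat_vec[of _ ?n ?n] smult_smult_assoc mult.commute)
  have "S = transpose_mat W * (A * W)" unfolding S_def using W A by (intro assoc_mult_mat) auto
  hence "col S 0 = transpose_mat W *\<^sub>v col (A * W) 0"
    using W A by (metis col_mult2 mult_carrier_mat transpose_carrier_mat zero_less_Suc)
  also have "\<dots> = transpose_mat W *\<^sub>v (e \<cdot>\<^sub>v col W 0)"
    using col_mult2[OF A W zero_less_Suc] AW0 by simp
  also have "\<dots> = e \<cdot>\<^sub>v (transpose_mat W *\<^sub>v col W 0)"
    using W v by (intro mult_mat_vec) (auto simp: W0)
  also have "transpose_mat W *\<^sub>v col W 0 = col (transpose_mat W * W) 0"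
    using W by (intro col_mult2[symmetric]) auto
  finally have S0: "col S 0 = e \<cdot>\<^sub>v unit_vec ?n 0" by (simp add: WW)
  have Si0: "S $$ (i, 0) = (if i = 0 then e else 0)" if "i < ?n" for i
    using arg_cong[OF S0, of "\<lambda>w. w $ i"] that S by (auto simp: unit_vec_def)
  have S0j: "S $$ (0, j) = (if j = 0 then e else 0)" if "j < ?n" for j
    using Si0[OF that] arg_cong[OF symS, of "\<lambda>M. M $$ (j, 0)"] that S by auto
  define B where "B = mat m m (\<lambda>(i, j). S $$ (Suc i, Suc j))"
  have B: "B \<in> carrier_mat m m" by (simp add: B_def)
  have Sblock: "S = four_block_mat (mat_diag 1 (\<lambda>_. e)) (0\<^sub>m 1 m) (0\<^sub>m m 1) B"
    using S by (intro eq_matI) (auto simp: B_def mat_diag_def Si0 S0j)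
  have "transpose_mat B = B"
  proof (rule eq_matI)
    fix i j assume "i < dim_row B" "j < dim_col B"
    thus "transpose_mat B $$ (i, j) = B $$ (i, j)"
      using arg_cong[OF symS, of "\<lambda>M. M $$ (Suc i, Suc j)"] S by (simp add: B_def)
  qed (use B in auto)
  from Suc.IH[OF B this] obtain Q d where Q: "Q \<in> carrier_mat m m"
    and QQ: "transpose_mat Q * Q = 1\<^sub>m m" and QBQ: "transpose_mat Q * B * Q = mat_diag m d" by auto
  define R where "R = four_block_mat (1\<^sub>m 1) (0\<^sub>m 1 m) (0\<^sub>m m 1) Q"
  have R: "R \<in> carrier_mat ?n ?n"
    unfolding R_def using four_block_carrier_mat[OF one_carrier_mat[of 1] Q] by simp
  have Rt: "transpose_mat R = four_block_mat (1\<^sub>m 1) (0\<^sub>m 1 m) (0\<^sub>m m 1) (transpose_mat Q)"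
    unfolding R_def using transpose_four_block_mat[OF one_carrier_mat[of 1] zero_carrier_mat zero_carrier_mat Q]
    by simp
  note unit = left_mult_one_mat[OF mat_diag_dim[of 1]] right_mult_one_mat[OF mat_diag_dim[of 1]]
  note block = mult_block_diagonal[of _ 1 _ _ m]
  have RR: "transpose_mat R * R = 1\<^sub>m ?n"
  proof -
    have "transpose_mat R * R = four_block_mat (1\<^sub>m 1) (0\<^sub>m 1 m) (0\<^sub>m m 1) (1\<^sub>m m)"
      unfolding Rt unfolding R_def using Q by (subst block) (auto simp: QQ)
    also have "\<dots> = 1\<^sub>m ?n" by (rule eq_matI) auto
    finally show ?thesis .
  qed
  have RSR: "transpose_mat R * S * R = mat_diag ?n (case_nat e d)"
  proof -
    have "transpose_mat R * S = four_block_mat (mat_diag 1 (\<lambda>_. e)) (0\<^sub>m 1 m) (0\<^sub>m m 1) (transpose_mat Q * B)"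
      unfolding Rt Sblock using Q B mat_diag_dim by (subst block) (auto simp: unit simp del: One_nat_def)
    hence "transpose_mat R * S * R
        = four_block_mat (mat_diag 1 (\<lambda>_. e)) (0\<^sub>m 1 m) (0\<^sub>m m 1) (transpose_mat Q * B * Q)"
      unfolding R_def using Q B by (simp only:) (subst block, auto simp: unit simp del: One_nat_def)
    thus ?thesis by (subst mat_diag_Suc) (simp add: QBQ)
  qed
  show ?case
  proof (intro exI conjI)
    show "W * R \<in> carrier_mat ?n ?n" using W R by simp
    have "transpose_mat (W * R) * (W * R) = transpose_mat R * (transpose_mat W * W) * R"
      using W R by (simp add: transpose_mult[of _ ?n ?n _ ?n] assoc_mult_mat[of _ ?n ?n _ ?n _ ?n])
    thus "transpose_mat (W * R) * (W * R) = 1\<^sub>m ?n" using R by (simp add: WW RR)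
    have "transpose_mat (W * R) * A * (W * R) = transpose_mat R * S * R"
      using W R A by (simp add: S_def transpose_mult[of _ ?n ?n _ ?n] assoc_mult_mat[of _ ?n ?n _ ?n _ ?n])
    thus "transpose_mat (W * R) * A * (W * R) = mat_diag ?n (case_nat e d)" using RSR by simp
  qed
qed

section \<open>The law of inertia\<close>

text \<open>Padding the system with zero equations makes it square with determinant zero.\<close>

lemma underdetermined_system_solution:
  fixes rs :: "'a :: field vec list"
  assumes rs: "set rs \<subseteq> carrier_vec n" and len: "length rs < n"
  shows "\<exists>x \<in> carrier_vec n. x \<noteq> 0\<^sub>v n \<and> (\<forall>r \<in> set rs. r \<bullet> x = 0)"
proof -
  define vs where "vs = rs @ replicate (n - length rs) (0\<^sub>v n)"
  define M where "M = mat_of_rows n vs"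
  have vs: "length vs = n" "vs ! (n - 1) = 0\<^sub>v n" "\<And>i. i < length rs \<Longrightarrow> vs ! i = rs ! i"
    using len by (auto simp: vs_def nth_append)
  have rowM: "row M i = vs ! i" if "i < n" for i
  proof -
    have "vs ! i \<in> carrier_vec n" using that rs by (auto simp: vs_def nth_append)
    thus ?thesis unfolding M_def using that vs(1) by (intro mat_of_rows_row) auto
  qed
  have M: "M \<in> carrier_mat n n" using mat_of_rows_carrier(1)[of n vs] vs(1) by (simp add: M_def)
  have last: "row M (n - 1) = 0\<^sub>v n"
    using rowM[of "n - 1"] vs(2) len by simp
  have "M = mat\<^sub>r n n (\<lambda>i. if i = n - 1 then 0\<^sub>v n else row M i)" (is "_ = ?M'")
  proof (rule eq_rowI)
    fix i assume "i < dim_row ?M'"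
    thus "row M i = row ?M' i" using last M by auto
  qed (use M in auto)
  moreover have "det ?M' = 0"
    using M len by (intro det_row_0) auto
  ultimately have "det M = 0" by simp
  then obtain x where x: "x \<in> carrier_vec n" "x \<noteq> 0\<^sub>v n" "M *\<^sub>v x = 0\<^sub>v n"
    using det_0_iff_vec_prod_zero[OF M] by auto
  have "r \<bullet> x = 0" if "r \<in> set rs" for r
  proof -
    from that obtain i where i: "i < length rs" "r = rs ! i" by (auto simp: in_set_conv_nth)
    have "row M i = r"
      using rowM[of i] vs(3) i len by simp
    thus ?thesis using arg_cong[OF x(3), of "\<lambda>y. y $ i"] i len M by simp
  qed
  with x show ?thesis by blast
qed

lemma quadratic_form_mat_diag:
  fixes x :: "real vec"
  assumes "x \<in> carrier_vec n"
  shows "x \<bullet> (mat_diag n d *\<^sub>v x) = (\<Sum>i<n. d i * (x $ i)\<^sup>2)"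
proof -
  have "mat_diag n d *\<^sub>v x = vec n (\<lambda>i. d i * x $ i)"
    using assms by (intro eq_vecI) (auto simp: mat_diag_def scalar_prod_def if_distrib[of "\<lambda>t. t * _"] cong: if_cong)
  thus ?thesis using assms
    by (simp add: scalar_prod_def atLeast0LessThan power2_eq_square mult_ac)
qed

text \<open>If \<open>e\<close> had more negative entries than \<open>d\<close>, there would be a vector \<open>x \<noteq> 0\<close> supported
  where \<open>e\<close> is negative such that \<open>R x\<close> vanishes where \<open>d\<close> is negative, as this asks for
  fewer than \<open>n\<close> linear equations. The common value of the two quadratic forms would then
  be both negative and non-negative.\<close>

lemma negative_entries_le_of_congruent:
  fixes R :: "real mat"
  assumes R: "R \<in> carrier_mat n n"
    and eq: "mat_diag n e = transpose_mat R * mat_diag n d * R"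
  shows "card {i. i < n \<and> e i < 0} \<le> card {i. i < n \<and> d i < 0}"
proof (rule ccontr)
  assume "\<not> ?thesis"
  hence lt: "card {i. i < n \<and> d i < 0} < card {i. i < n \<and> e i < 0}" by simp
  \<comment> \<open>the equations for \<open>x\<close>: entries outside the negative set of \<open>e\<close> vanish, and so do the
    entries of \<open>R x\<close> in the negative set of \<open>d\<close>\<close>
  define rs where "rs = map (unit_vec n) (filter (\<lambda>i. \<not> e i < 0) [0..<n])
      @ map (row R) (filter (\<lambda>i. d i < 0) [0..<n])"
  have cnt: "length (filter p [0..<n]) = card {i. i < n \<and> p i}" for p
    by (auto simp: length_filter_conv_card intro!: arg_cong[of _ _ card])
  have "{..<n} = {i. i < n \<and> e i < 0} \<union> {i. i < n \<and> \<not> e i < 0}" by auto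
  hence "n = card {i. i < n \<and> e i < 0} + card {i. i < n \<and> \<not> e i < 0}"
    by (metis (no_types, lifting) card_Un_disjoint card_lessThan disjoint_iff finite_Un finite_lessThan mem_Collect_eq)
  with lt have len: "length rs < n" unfolding rs_def length_append length_map cnt by linarith
  have "set rs \<subseteq> carrier_vec n" using R by (auto simp: rs_def)
  from underdetermined_system_solution[OF this len] obtain x
    where x: "x \<in> carrier_vec n" "x \<noteq> 0\<^sub>v n" and rx: "\<And>r. r \<in> set rs \<Longrightarrow> r \<bullet> x = 0" by auto
  have x0: "x $ i = 0" if "i < n" "\<not> e i < 0" for i
    using rx[of "unit_vec n i"] that x by (auto simp: rs_def)
  have Rx: "R *\<^sub>v x \<in> carrier_vec n" using R x by simp
  have Rx0: "(R *\<^sub>v x) $ i = 0" if "i < n" "d i < 0" for i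
    using rx[of "row R i"] that R by (auto simp: rs_def)
  have "x \<bullet> (mat_diag n e *\<^sub>v x) = x \<bullet> (transpose_mat R *\<^sub>v (mat_diag n d *\<^sub>v (R *\<^sub>v x)))"
    unfolding eq using R x by (simp add: assoc_mult_mat_vec[of _ n n _ n])
  also have "\<dots> = (transpose_mat R *\<^sub>v (mat_diag n d *\<^sub>v (R *\<^sub>v x))) \<bullet> x"
    using R x Rx by (intro comm_scalar_prod[of _ n] mult_mat_vec_carrier[of _ n n]) auto
  also have "\<dots> = (mat_diag n d *\<^sub>v (R *\<^sub>v x)) \<bullet> (R *\<^sub>v x)"
    using R x Rx by (intro transpose_vec_mult_scalar[of _ n n] mult_mat_vec_carrier[of _ n n]) auto
  also have "\<dots> = (R *\<^sub>v x) \<bullet> (mat_diag n d *\<^sub>v (R *\<^sub>v x))"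
    using Rx by (intro comm_scalar_prod[of _ n] mult_mat_vec_carrier[of "mat_diag n d" n n]) auto
  finally have forms: "(\<Sum>i<n. e i * (x $ i)\<^sup>2) = (\<Sum>i<n. d i * ((R *\<^sub>v x) $ i)\<^sup>2)"
    unfolding quadratic_form_mat_diag[OF x(1)] quadratic_form_mat_diag[OF Rx] .
  have ge: "(\<Sum>i<n. d i * ((R *\<^sub>v x) $ i)\<^sup>2) \<ge> 0"
  proof (rule sum_nonneg)
    fix i assume "i \<in> {..<n}"
    thus "0 \<le> d i * ((R *\<^sub>v x) $ i)\<^sup>2" using Rx0[of i] by (cases "d i < 0") auto
  qed
  from x obtain k where k: "k < n" "x $ k \<noteq> 0" by (auto simp: vec_eq_iff)
  have "(\<Sum>i<n. - (e i * (x $ i)\<^sup>2)) > 0"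
  proof (rule sum_pos2[of _ k])
    have "e k < 0" using x0 k by blast
    thus "0 < - (e k * (x $ k)\<^sup>2)" using k by (simp add: mult_neg_pos)
    fix i assume "i \<in> {..<n}"
    thus "0 \<le> - (e i * (x $ i)\<^sup>2)"
      using x0[of i] by (cases "e i < 0") (auto simp: mult_nonpos_nonneg)
  qed (use k in auto)
  with forms ge show False by (simp add: sum_negf)
qed


text \<open>Since \<open>P\<^sup>T\<close> is the inverse of \<open>P\<close>, the congruence is a similarity as well. This is
  what ties the characteristic polynomial to the diagonal entries.\<close>

lemma orthogonal_diagonalization:
  fixes A P :: "real mat"
  assumes A: "A \<in> carrier_mat n n" and P: "P \<in> carrier_mat n n"
    and PP: "transpose_mat P * P = 1\<^sub>m n" and PAP: "transpose_mat P * A * P = mat_diag n d"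
  shows "A = P * mat_diag n d * transpose_mat P"
    and "char_poly A = (\<Prod>i\<leftarrow>[0..<n]. [:- d i, 1:])"
    and "det A = (\<Prod>i\<leftarrow>[0..<n]. d i)"
proof -
  have Pt: "transpose_mat P \<in> carrier_mat n n" using P by simp
  have PP': "P * transpose_mat P = 1\<^sub>m n" by (rule mat_mult_left_right_inverse[OF Pt P PP])
  have "similar_mat_wit (mat_diag n d) A (transpose_mat P) P"
    by (rule similar_mat_witI[of _ _ n]) (use A P PP PP' PAP in auto)
  hence wit: "similar_mat_wit A (mat_diag n d) P (transpose_mat P)" by (rule similar_mat_wit_sym)
  thus "A = P * mat_diag n d * transpose_mat P" by (auto simp: similar_mat_wit_def Let_def)
  from wit have sim: "similar_mat A (mat_diag n d)" by (auto simp: similar_mat_def)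
  have ut: "upper_triangular (mat_diag n d)" by (auto simp: mat_diag_def)
  have diag: "diag_mat (mat_diag n d) = map d [0..<n]" by (auto simp: diag_mat_def mat_diag_def)
  show "char_poly A = (\<Prod>i\<leftarrow>[0..<n]. [:- d i, 1:])"
    using char_poly_similar[OF sim] char_poly_upper_triangular[OF mat_diag_dim ut]
    by (simp add: diag o_def)
  show "det A = (\<Prod>i\<leftarrow>[0..<n]. d i)"
    using det_similar[OF sim] det_upper_triangular[OF ut mat_diag_dim] by (simp add: diag)
qed

lemma proots_prod_linear_factors:
  fixes d :: "nat \<Rightarrow> 'a :: idom"
  shows "proots (\<Prod>i\<leftarrow>ns. [:- d i, 1:]) = image_mset d (mset ns)"
proof (induction ns)
  case (Cons a ns)
  have "(\<Prod>i\<leftarrow>ns. [:- d i, 1:]) \<noteq> 0" by (auto simp: prod_list_zero_iff)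
  thus ?case using Cons by (simp add: proots_mult del: mult_pCons_left)
qed simp

lemma symmetric_real_eigenvalues:
  fixes A :: "real mat"
  assumes A: "A \<in> carrier_mat n n" and sym: "transpose_mat A = A"
  shows "\<exists>P d. P \<in> carrier_mat n n \<and> transpose_mat P * P = 1\<^sub>m n \<and> transpose_mat P * A * P = mat_diag n d
    \<and> eigenvalues_mset A = image_mset d (mset [0..<n])"
proof -
  from real_spectral_theorem[OF assms] obtain P d where
    P: "P \<in> carrier_mat n n" "transpose_mat P * P = 1\<^sub>m n" "transpose_mat P * A * P = mat_diag n d"
    by blast
  have "eigenvalues_mset A = image_mset d (mset [0..<n])"
    unfolding eigenvalues_mset_def orthogonal_diagonalization(2)[OF A P]
    by (rule proots_prod_linear_factors)
  with P show ?thesis by blast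
qed

lemma det_symmetric_eq_prod_eigenvalues:
  fixes A :: "real mat"
  assumes A: "A \<in> carrier_mat n n" and sym: "transpose_mat A = A"
  shows "det A = \<Prod>\<^sub># (eigenvalues_mset A)"
proof -
  from symmetric_real_eigenvalues[OF assms] obtain P d where
    P: "P \<in> carrier_mat n n" "transpose_mat P * P = 1\<^sub>m n" "transpose_mat P * A * P = mat_diag n d"
    and ev: "eigenvalues_mset A = image_mset d (mset [0..<n])"
    by blast
  show ?thesis unfolding orthogonal_diagonalization(3)[OF A P] ev
    by (metis mset_map prod_mset_prod_list)
qed

text \<open>By the spectral theorem \<open>A\<close> is congruent to the diagonal matrix of its eigenvalues. This
  matrix and \<open>mat_diag n d\<close> are therefore congruent to each other in both directions, and
  \<open>negative_entries_le_of_congruent\<close> applies twice.\<close>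

theorem sylvester_law_of_inertia:
  fixes A Z :: "real mat"
  assumes Z: "Z \<in> carrier_mat n n" and detZ: "det Z \<noteq> 0"
    and A: "A = Z * mat_diag n d * transpose_mat Z"
  shows "morse_index A = card {i. i < n \<and> d i < 0}"
proof -
  have Ac: "A \<in> carrier_mat n n" unfolding A using Z by auto
  have tdiag: "transpose_mat (mat_diag n f) = mat_diag n f" for f :: "nat \<Rightarrow> real"
    by (rule eq_matI) (auto simp: mat_diag_def)
  note assoc = assoc_mult_mat[of _ n n _ n _ n]
  have sym: "transpose_mat A = A"
    unfolding A using Z by (simp add: transpose_mult[of _ n n _ n] assoc mult_carrier_mat[of _ n n] tdiag)
  from symmetric_real_eigenvalues[OF Ac sym] obtain P e where
    P: "P \<in> carrier_mat n n" "transpose_mat P * P = 1\<^sub>m n" "transpose_mat P * A * P = mat_diag n e"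
    and ev: "eigenvalues_mset A = image_mset e (mset [0..<n])"
    by blast
  note A' = orthogonal_diagonalization(1)[OF Ac P]
  obtain Y where Y: "Y \<in> carrier_mat n n" and YZ: "Y * Z = 1\<^sub>m n"
    using det_non_zero_imp_unit[OF Z detZ] by (auto simp: Units_def ring_mat_def)
  have ZYt: "transpose_mat Z * transpose_mat Y = 1\<^sub>m n"
    using transpose_mult[OF Y Z] YZ by simp
  have Yt: "transpose_mat Y \<in> carrier_mat n n" and Zt: "transpose_mat Z \<in> carrier_mat n n"
    and Pt: "transpose_mat P \<in> carrier_mat n n" using Y Z P by auto
  have "mat_diag n e = transpose_mat (transpose_mat Z * P) * mat_diag n d * (transpose_mat Z * P)"
    unfolding P(3)[symmetric] A using Z P(1) by (simp add: transpose_mult[of _ n n _ n] assoc mult_carrier_mat[of _ n n])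
  hence le: "card {i. i < n \<and> e i < 0} \<le> card {i. i < n \<and> d i < 0}"
    by (rule negative_entries_le_of_congruent[rotated]) (use Z P in auto)
  have "mat_diag n d = (Y * Z) * mat_diag n d * (transpose_mat Z * transpose_mat Y)"
    using left_mult_one_mat[OF mat_diag_dim[of n d]] right_mult_one_mat[OF mat_diag_dim[of n d]]
    by (simp add: YZ ZYt)
  also have "\<dots> = Y * A * transpose_mat Y"
    unfolding A using Y Z by (simp add: assoc mult_carrier_mat[of _ n n])
  also have "\<dots> = transpose_mat (transpose_mat P * transpose_mat Y) * mat_diag n e * (transpose_mat P * transpose_mat Y)"
    using Y P(1) by (subst A') (simp add: transpose_mult[of _ n n _ n] assoc mult_carrier_mat[of _ n n])
  finally have ge: "card {i. i < n \<and> d i < 0} \<le> card {i. i < n \<and> e i < 0}"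
    by (rule negative_entries_le_of_congruent[rotated]) (use Y P in auto)
  have "morse_index A = length (filter (\<lambda>i. e i < 0) [0..<n])"
    unfolding morse_index_def ev
    by (simp add: filter_mset_image_mset size_mset[symmetric] mset_filter[symmetric] del: size_mset mset_filter mset_upt)
  also have "\<dots> = card {i. i < n \<and> e i < 0}"
    by (auto simp: length_filter_conv_card intro!: arg_cong[of _ _ card])
  finally show ?thesis using le ge by simp
qed

section \<open>The zeta function at the origin\<close>

text \<open>Any branch of the logarithm is inverted by \<open>exp\<close>, so the negative eigenvalues enter the
  product with their correct sign.\<close>

lemma exp_minus_deriv_spectral_zeta_0:
  assumes "0 \<notin># eigenvalues_mset A"
  shows "exp (- deriv (spectral_zeta A) 0) = complex_of_real (\<Prod>\<^sub># (eigenvalues_mset A))"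
proof -
  have "((\<lambda>s. \<Sum>l\<in>#M. complex_of_real l powr (- s)) has_field_derivative
      (\<Sum>l\<in>#M. - Ln (complex_of_real l))) (at 0)
    \<and> exp (- (\<Sum>l\<in>#M. - Ln (complex_of_real l))) = complex_of_real (\<Prod>\<^sub># M)"
    if "0 \<notin># M" for M
    using that
  proof (induction M)
    case (add x M)
    hence x: "complex_of_real x \<noteq> 0" and M: "0 \<notin># M" by auto
    let ?S = "\<Sum>l\<in>#M. - Ln (complex_of_real l)"
    have "((\<lambda>s. complex_of_real x powr (- s)) has_field_derivative - Ln (complex_of_real x)) (at 0)"
      by (rule DERIV_cong[OF DERIV_chain2[OF has_field_derivative_powr_right[OF x]
            DERIV_minus[OF DERIV_ident]]]) (use x in auto)
    from DERIV_add[OF this conjunct1[OF add.IH[OF M]]]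
    have "((\<lambda>s. \<Sum>l\<in>#add_mset x M. complex_of_real l powr (- s)) has_field_derivative
        (\<Sum>l\<in>#add_mset x M. - Ln (complex_of_real l))) (at 0)"
      by (simp only: image_mset_add_mset sum_mset.add_mset)
    moreover have "exp (- (- Ln (complex_of_real x) + ?S)) = exp (Ln (complex_of_real x)) * exp (- ?S)"
      by (simp add: exp_add[symmetric])
    hence "exp (- (\<Sum>l\<in>#add_mset x M. - Ln (complex_of_real l)))
        = complex_of_real (\<Prod>\<^sub># (add_mset x M))"
      unfolding conjunct2[OF add.IH[OF M]] exp_Ln[OF x]
      by (simp only: image_mset_add_mset sum_mset.add_mset prod_mset.add_mset of_real_mult)
    ultimately show ?case ..
  qed auto
  from this[OF assms] show ?thesis
    by (auto simp: spectral_zeta_def[abs_def] dest!: DERIV_imp_deriv)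
qed

section \<open>Factorization of the connection Laplacian\<close>

text \<open>The reduced Euler characteristic of a full simplex vanishes: expand the product of
  \<open>1 - 1\<close> over all elements of \<open>s\<close>. The empty set, left out here, contributes the 1.\<close>

lemma sum_nonempty_subsets_sign:
  assumes "finite s"
  shows "(\<Sum>z\<in>Pow s - {{}}. (- 1) ^ (card z - 1)) = (if s = {} then 0 else (1 :: 'b :: comm_ring_1))"
proof -
  have "(\<Sum>z\<in>Pow s - {{}}. (- 1) ^ (card z - 1)) = - (\<Sum>z\<in>Pow s - {{}}. (- 1 :: 'b) ^ card z)"
    unfolding sum_negf[symmetric]
  proof (intro sum.cong refl)
    fix z assume "z \<in> Pow s - {{}}"
    hence "card z \<noteq> 0" using assms by (auto simp: card_eq_0_iff dest: finite_subset)
    thus "(- 1) ^ (card z - 1) = - ((- 1 :: 'b) ^ card z)" by (cases "card z") auto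
  qed
  also have "(\<Sum>z\<in>Pow s - {{}}. (- 1 :: 'b) ^ card z) = (\<Sum>z\<in>Pow s. (- 1) ^ card z) - 1"
    using assms by (subst sum_diff) auto
  also have "(\<Sum>z\<in>Pow s. (- 1 :: 'b) ^ card z) = (\<Prod>x\<in>s. 1 - 1)"
    using prod_diff_conv_sum[OF assms, of "\<lambda>_. 1 :: 'b" "\<lambda>_. 1"] by simp
  also have "\<dots> = (if s = {} then 1 else 0)" using assms by (simp add: power_0_left)
  finally show ?thesis by simp
qed

definition face_matrix :: "'a set list \<Rightarrow> real mat" where
  "face_matrix xs = mat (length xs) (length xs) (\<lambda>(i, j). if xs ! j \<subseteq> xs ! i then 1 else 0)"

lemma face_matrix_carrier: "face_matrix xs \<in> carrier_mat (length xs) (length xs)"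
  by (simp add: face_matrix_def)

text \<open>A permutation does not change the sum of the cardinalities, so no inclusion can be
  proper.\<close>

lemma permutes_into_subsets_imp_id:
  assumes p: "p permutes {0..<length xs}" and dist: "distinct xs"
    and fin: "\<forall>x\<in>set xs. finite x" and sub: "\<And>i. i < length xs \<Longrightarrow> xs ! p i \<subseteq> xs ! i"
  shows "p = id"
proof
  fix i show "p i = id i"
  proof (cases "i < length xs")
    case True
    have le: "card (xs ! p k) \<le> card (xs ! k)" if "k < length xs" for k
      using fin sub that by (intro card_mono) auto
    have "(\<Sum>i\<in>{0..<length xs}. card (xs ! p i)) = (\<Sum>i\<in>{0..<length xs}. card (xs ! i))"
      using sum.permute[OF p, of "\<lambda>i. card (xs ! i)"] by (simp add: o_def)
    hence "card (xs ! p i) = card (xs ! i)"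
      by (rule sum_mono_inv) (use True in \<open>auto intro: le\<close>)
    hence "xs ! p i = xs ! i" using sub[OF True] fin True by (intro card_subset_eq) auto
    moreover have "p i < length xs" using permutes_in_image[OF p, of i] True by simp
    ultimately show ?thesis using dist True by (simp add: nth_eq_iff_index_eq)
  next
    case False
    thus ?thesis using p by (auto simp: permutes_def)
  qed
qed

text \<open>Only the identity contributes to the Leibniz formula. This replaces sorting the simplices
  by dimension, after which the matrix would be unitriangular.\<close>

lemma det_face_matrix:
  assumes dist: "distinct xs" and fin: "\<forall>x\<in>set xs. finite x"
  shows "det (face_matrix xs) = 1"
proof -
  let ?n = "length xs"
  have "det (face_matrix xs) = (\<Sum>p | p permutes {0..<?n}.
      signof p * (\<Prod>i = 0..<?n. face_matrix xs $$ (i, p i)))"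
    by (rule det_def'[OF face_matrix_carrier])
  also have "\<dots> = (\<Sum>p | p permutes {0..<?n}. if p = id then 1 else 0)"
  proof (intro sum.cong refl)
    fix p assume "p \<in> {p. p permutes {0..<?n}}"
    hence p: "p permutes {0..<?n}" by simp
    have pi: "p i < ?n" if "i < ?n" for i using permutes_in_image[OF p, of i] that by simp
    show "signof p * (\<Prod>i = 0..<?n. face_matrix xs $$ (i, p i)) = (if p = id then 1 else 0)"
    proof (cases "p = id")
      case True
      thus ?thesis by (simp add: face_matrix_def)
    next
      case False
      then obtain i where "i < ?n" "\<not> xs ! p i \<subseteq> xs ! i"
        using permutes_into_subsets_imp_id[OF p dist fin] by blast
      hence "\<exists>i\<in>{0..<?n}. face_matrix xs $$ (i, p i) = 0"
        using pi by (intro bexI[of _ i]) (auto simp: face_matrix_def)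
      with False show ?thesis by (simp add: prod_zero)
    qed
  qed
  also have "\<dots> = 1" using permutes_id by (simp add: sum.delta finite_permutations)
  finally show ?thesis .
qed

text \<open>The complex is closed under non-empty subsets, so the simplices contained in both
  \<open>xs ! i\<close> and \<open>xs ! j\<close> are exactly the non-empty subsets of the intersection, and
  \<open>sum_nonempty_subsets_sign\<close> gives the matrix entry.\<close>

lemma connection_laplacian_factorization:
  assumes G: "simplicial_complex (set xs)" and dist: "distinct xs"
  shows "connection_laplacian xs = face_matrix xs
    * mat_diag (length xs) (\<lambda>i. (- 1) ^ (card (xs ! i) - 1)) * transpose_mat (face_matrix xs)"
    (is "_ = ?Z * mat_diag ?n ?d * _")
proof (rule eq_matI)
  note Z = face_matrix_carrier[of xs]
  fix i j assume "i < dim_row (?Z * mat_diag ?n ?d * transpose_mat ?Z)"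
    "j < dim_col (?Z * mat_diag ?n ?d * transpose_mat ?Z)"
  hence ij: "i < ?n" "j < ?n" using Z by auto
  let ?s = "xs ! i \<inter> xs ! j"
  have fin: "finite ?s" using G ij by (auto simp: simplicial_complex_def)
  have faces: "{z \<in> set xs. z \<subseteq> ?s} = Pow ?s - {{}}"
    using G ij unfolding simplicial_complex_def by (auto dest: nth_mem)
  have "(?Z * mat_diag ?n ?d * transpose_mat ?Z) $$ (i, j)
      = (\<Sum>k<?n. ?Z $$ (i, k) * ?d k * ?Z $$ (j, k))"
    using ij Z by (simp add: mat_diag_mult_right[OF Z] scalar_prod_def atLeast0LessThan)
  also have "\<dots> = (\<Sum>k<?n. if xs ! k \<subseteq> ?s then ?d k else 0)"
    using ij by (intro sum.cong refl) (auto simp: face_matrix_def)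
  also have "\<dots> = (\<Sum>z\<in>set xs. if z \<subseteq> ?s then (- 1) ^ (card z - 1) else 0)"
    using bij_betw_nth[OF dist refl refl] by (rule sum.reindex_bij_betw)
  also have "\<dots> = (\<Sum>z\<in>Pow ?s - {{}}. (- 1) ^ (card z - 1))"
    unfolding faces[symmetric] by (rule sum.inter_filter[symmetric]) simp
  also have "\<dots> = (if ?s = {} then 0 else 1)"
    by (rule sum_nonempty_subsets_sign[OF fin])
  also have "\<dots> = connection_laplacian xs $$ (i, j)"
    using ij by (simp add: connection_laplacian_def)
  finally show "connection_laplacian xs $$ (i, j) = (?Z * mat_diag ?n ?d * transpose_mat ?Z) $$ (i, j)" ..
qed (simp_all add: connection_laplacian_def face_matrix_def)

theorem proposition2:
  fixes G :: "'a set set" and xs :: "'a set list" and L :: "real mat"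
  assumes "simplicial_complex G"
    and "distinct xs" and "set xs = G"
    and "L = connection_laplacian xs"
  shows "morse_index L = card {x \<in> G. odd (simplex_dim x)}
    \<and> (-1) ^ morse_index L = exp (- deriv (spectral_zeta L) 0)
    \<and> exp (- deriv (spectral_zeta L) 0) = complex_of_real (Determinant.det L)"
proof -
  let ?n = "length xs" and ?Z = "face_matrix xs"
  define d where "d i = (- 1 :: real) ^ (card (xs ! i) - 1)" for i
  have G: "simplicial_complex (set xs)" using assms by simp
  have fin: "\<forall>x\<in>set xs. finite x" and ne: "{} \<notin> set xs" using G by (auto simp: simplicial_complex_def)
  note Z = face_matrix_carrier[of xs]
  have detZ: "det ?Z = 1" using det_face_matrix[OF assms(2) fin] .
  have L: "L = ?Z * mat_diag ?n d * transpose_mat ?Z"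
    unfolding assms(4) d_def by (rule connection_laplacian_factorization[OF G assms(2)])
  have Lc: "L \<in> carrier_mat ?n ?n" by (simp add: assms(4) connection_laplacian_def)
  have sym: "transpose_mat L = L"
    by (rule eq_matI) (auto simp: assms(4) connection_laplacian_def Int_commute)
  have neg: "d i < 0 \<longleftrightarrow> odd (simplex_dim (xs ! i))" if "i < ?n" for i
  proof -
    have "xs ! i \<in> set xs" using that by simp
    hence "card (xs ! i) > 0" using fin ne by (metis card_gt_0_iff)
    hence "simplex_dim (xs ! i) = int (card (xs ! i) - 1)" by (simp add: simplex_dim_def)
    thus ?thesis by (cases "even (card (xs ! i) - 1)") (auto simp: d_def)
  qed
  have "bij_betw ((!) xs) {i. i < ?n \<and> d i < 0} {x \<in> G. odd (simplex_dim x)}"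
    unfolding bij_betw_def inj_on_def assms(3)[symmetric]
    using assms(2) neg by (fastforce simp: nth_eq_iff_index_eq in_set_conv_nth image_iff)
  moreover have morse: "morse_index L = card {i. i < ?n \<and> d i < 0}"
    using sylvester_law_of_inertia[OF Z _ L] detZ by simp
  ultimately have index: "morse_index L = card {x \<in> G. odd (simplex_dim x)}"
    by (simp add: bij_betw_same_card)
  have "det L = det (mat_diag ?n d)"
    unfolding L using Z
    by (simp add: det_mult[of _ ?n] det_transpose[of _ ?n] detZ)
  also have "\<dots> = (\<Prod>i<?n. d i)"
    by (subst det_upper_triangular[OF _ mat_diag_dim])
      (auto simp: prod_list_diag_prod mat_diag_def atLeast0LessThan)
  also have "\<dots> = (\<Prod>i<?n. if d i < 0 then - 1 else 1)"
    by (intro prod.cong refl) (auto simp: d_def minus_one_power_iff)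
  also have "\<dots> = (- 1) ^ card {i. i < ?n \<and> d i < 0}"
    by (subst prod.If_cases) (auto intro!: arg_cong[of _ _ "\<lambda>S. (- 1) ^ card S"])
  finally have detL: "det L = (- 1) ^ morse_index L" by (simp add: morse)
  have detev: "det L = \<Prod>\<^sub># (eigenvalues_mset L)"
    by (rule det_symmetric_eq_prod_eigenvalues[OF Lc sym])
  have "\<Prod>\<^sub># (eigenvalues_mset L) \<noteq> 0" unfolding detev[symmetric] detL by simp
  hence "0 \<notin># eigenvalues_mset L" by (simp add: prod_mset_zero_iff)
  from exp_minus_deriv_spectral_zeta_0[OF this]
  have "exp (- deriv (spectral_zeta L) 0) = complex_of_real (det L)" by (simp add: detev)
  moreover have "complex_of_real (det L) = (- 1) ^ morse_index L" by (simp add: detL)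
  ultimately show ?thesis using index by simp
qed

end
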